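(* Let $\phi=\frac{1+\sqrt5}{2}$ and let $g:\mathbb{Z}_{\geq 0}\to\{0,1\}$ be defined by $g(0)=1$, $g(1)=0$ and, for $n\ge 2$, $g(n)=1-g(m)$ if there is $m\in\mathbb{Z}_{\geq0}$ with $\lfloor n\phi\rfloor=\lfloor m(\phi+1)\rfloor+1$, and $g(n)=1$ otherwise. Let $P_{1,1}=\{(\lfloor n\phi\rfloor+g(n)-1,\ \lfloor n(\phi+1)\rfloor+g(n)) : n\in\mathbb{Z}_{\geq0}\}$, $P_{1,2}=\{(\lfloor n(\phi+1)\rfloor+g(n),\ \lfloor n\phi\rfloor+g(n)-1) : n\in\mathbb{Z}_{\geq0}\}$ and $P_1=P_{1,1}\cup P_{1,2}\cup\{(0,0),(1,1)\}$. Then the set of $\mathcal{P}$-positions of the variant of Wythoff's game with terminal set $T=\{(x,y):x+y\le 2\}$ (described in the context) is exactly $P_1$.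
   Context: Wythoff's game moves: from a position $(x,y)\in\mathbb{Z}_{\geq0}^2$ a player may move to any $(u,y)$ with $0\le u<x$, any $(x,v)$ with $0\le v<y$, or any $(x-t,y-t)$ with $1\le t\le\min(x,y)$. In the variant considered here, the play is the same, but the game ends as soon as the position lies in the terminal set $T=\{(x,y):x+y\le 2\}=\{(0,0),(1,0),(0,1),(1,1),(2,0),(0,2)\}$; positions in $T$ have no moves, and the player who moves the position into $T$ wins (normal play). Two players alternate. A $\mathcal{P}$-position is a position from which the previous player (the one who has just moved) wins with correct play; an $\mathcal{N}$-position is one from which the next player wins. *)

theory Defs
  imports Complex_Main
begin

definition \<phi> :: real where
  "\<phi> = (1 + sqrt 5) / 2"

lemma phi_gt_1: "\<phi> > 1"
proof -
  have "sqrt 5 > sqrt 1" by (rule real_sqrt_less_mono) simp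
  then show ?thesis by (simp add: \<phi>_def)
qed

lemma link_less:
  assumes "\<lfloor>real n * \<phi>\<rfloor> = \<lfloor>real m * (\<phi> + 1)\<rfloor> + 1"
  shows "m < n"
proof (rule ccontr)
  assume "\<not> m < n"
  then have "real n * \<phi> \<le> real m * (\<phi> + 1)"
    using phi_gt_1 by (intro mult_mono) auto
  then have "\<lfloor>real n * \<phi>\<rfloor> \<le> \<lfloor>real m * (\<phi> + 1)\<rfloor>" by (rule floor_mono)
  with assms show False by simp
qed

lemma floor_phi_plus_1_inj:
  assumes "\<lfloor>real m * (\<phi> + 1)\<rfloor> = \<lfloor>real k * (\<phi> + 1)\<rfloor>"
  shows "m = k"
proof -
  have *: False if "i < j" "\<lfloor>real i * (\<phi> + 1)\<rfloor> = \<lfloor>real j * (\<phi> + 1)\<rfloor>" for i j :: nat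
  proof -
    have "(real i + 1) * (\<phi> + 1) \<le> real j * (\<phi> + 1)"
      using that(1) phi_gt_1 by (intro mult_right_mono) auto
    then have "real i * (\<phi> + 1) + 1 \<le> real j * (\<phi> + 1)"
      using phi_gt_1 by (simp add: algebra_simps)
    then have "\<lfloor>real i * (\<phi> + 1) + 1\<rfloor> \<le> \<lfloor>real j * (\<phi> + 1)\<rfloor>" by (rule floor_mono)
    with that(2) show False by simp
  qed
  show ?thesis using *[of m k] *[of k m] assms by (metis linorder_neqE_nat)
qed

lemma the_link:
  assumes "\<lfloor>real n * \<phi>\<rfloor> = \<lfloor>real m * (\<phi> + 1)\<rfloor> + 1"
  shows "(THE m. \<lfloor>real n * \<phi>\<rfloor> = \<lfloor>real m * (\<phi> + 1)\<rfloor> + 1) = m"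
  using assms floor_phi_plus_1_inj by (intro the_equality) auto

text \<open>The index \<open>m\<close> in the recursion is unique and smaller than \<open>n\<close>
  (lemmas \<open>the_link\<close> and \<open>link_less\<close>).\<close>

function g :: "nat \<Rightarrow> int" where
  "g n =
    (if n = 0 then 1
     else if n = 1 then 0
     else if \<exists>m. \<lfloor>real n * \<phi>\<rfloor> = \<lfloor>real m * (\<phi> + 1)\<rfloor> + 1
       then 1 - g (THE m. \<lfloor>real n * \<phi>\<rfloor> = \<lfloor>real m * (\<phi> + 1)\<rfloor> + 1)
     else 1)"
  by auto
termination
proof (relation "measure id")
  fix n :: nat
  assume "\<exists>m. \<lfloor>real n * \<phi>\<rfloor> = \<lfloor>real m * (\<phi> + 1)\<rfloor> + 1"
  then show "((THE m. \<lfloor>real n * \<phi>\<rfloor> = \<lfloor>real m * (\<phi> + 1)\<rfloor> + 1), n) \<in> measure id"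
    using the_link link_less by auto
qed simp

declare g.simps [simp del]

lemma g_0: "g 0 = 1" and g_1: "g 1 = 0"
  by (simp_all add: g.simps)

lemma g_link:
  assumes "n \<ge> 2" and "\<lfloor>real n * \<phi>\<rfloor> = \<lfloor>real m * (\<phi> + 1)\<rfloor> + 1"
  shows "g n = 1 - g m"
proof -
  have "\<exists>m. \<lfloor>real n * \<phi>\<rfloor> = \<lfloor>real m * (\<phi> + 1)\<rfloor> + 1" using assms(2) by blast
  then show ?thesis using assms(1) by (subst g.simps) (simp only: the_link[OF assms(2)], simp)
qed

lemma g_no_link:
  assumes "n \<ge> 2" and "\<nexists>m. \<lfloor>real n * \<phi>\<rfloor> = \<lfloor>real m * (\<phi> + 1)\<rfloor> + 1"
  shows "g n = 1"
  using assms by (subst g.simps) simp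

definition P11 :: "(int \<times> int) set" where
  "P11 = {(\<lfloor>real n * \<phi>\<rfloor> + g n - 1, \<lfloor>real n * (\<phi> + 1)\<rfloor> + g n) | n :: nat. True}"

definition P12 :: "(int \<times> int) set" where
  "P12 = {(\<lfloor>real n * (\<phi> + 1)\<rfloor> + g n, \<lfloor>real n * \<phi>\<rfloor> + g n - 1) | n :: nat. True}"

definition P1 :: "(int \<times> int) set" where
  "P1 = P11 \<union> P12 \<union> {(0, 0), (1, 1)}"

type_synonym position = "nat \<times> nat"

inductive wythoff_move :: "position \<Rightarrow> position \<Rightarrow> bool" where
  horizontal: "u < x \<Longrightarrow> wythoff_move (x, y) (u, y)"
| vertical: "v < y \<Longrightarrow> wythoff_move (x, y) (x, v)"
| diagonal: "1 \<le> t \<Longrightarrow> t \<le> min x y \<Longrightarrow> wythoff_move (x, y) (x - t, y - t)"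

definition terminal_set :: "position set" where
  "terminal_set = {(x, y). x + y \<le> 2}"

definition move :: "position \<Rightarrow> position \<Rightarrow> bool" where
  "move p q \<longleftrightarrow> p \<notin> terminal_set \<and> wythoff_move p q"

text \<open>A complete play from \<open>p\<close> is the list of successive positions. It is finite since every move
  decreases the coordinate sum. The moves made at even indices are those of the next player, the
  moves made at odd indices those of the previous player.\<close>

definition play_from :: "position \<Rightarrow> position list \<Rightarrow> bool" where
  "play_from p ps \<longleftrightarrow>
     ps \<noteq> [] \<and> hd ps = p \<and>
     (\<forall>i. Suc i < length ps \<longrightarrow> move (ps ! i) (ps ! Suc i)) \<and>
     last ps \<in> terminal_set"

definition strategy :: "(position \<Rightarrow> position) \<Rightarrow> bool" where
  "strategy \<sigma> \<longleftrightarrow> (\<forall>p. p \<notin> terminal_set \<longrightarrow> move p (\<sigma> p))"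

definition previous_follows :: "(position \<Rightarrow> position) \<Rightarrow> position list \<Rightarrow> bool" where
  "previous_follows \<sigma> ps \<longleftrightarrow> (\<forall>i. odd i \<and> Suc i < length ps \<longrightarrow> ps ! Suc i = \<sigma> (ps ! i))"

text \<open>The last of the \<open>length ps - 1\<close> moves is made by the previous player iff this
  number is even; for a play without moves, the previous player is the one who has just moved into
  the terminal set.\<close>

definition previous_wins_play :: "position list \<Rightarrow> bool" where
  "previous_wins_play ps \<longleftrightarrow> even (length ps - 1)"

definition P_position :: "position \<Rightarrow> bool" where
  "P_position p \<longleftrightarrow>
     (\<exists>\<sigma>. strategy \<sigma> \<and>
       (\<forall>ps. play_from p ps \<and> previous_follows \<sigma> ps \<longrightarrow> previous_wins_play ps))"

lemma move_decreases: "move p q \<Longrightarrow> fst q + snd q < fst p + snd p"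
  by (auto simp: move_def elim!: wythoff_move.cases)

lemma move_exists: "p \<notin> terminal_set \<Longrightarrow> \<exists>q. move p q"
proof -
  assume p: "p \<notin> terminal_set"
  obtain x y where xy: "p = (x, y)" by fastforce
  have "x > 0 \<or> y > 0" using p by (auto simp: xy terminal_set_def)
  then have "wythoff_move p (0, y) \<or> wythoff_move p (x, 0)"
    using wythoff_move.intros by (auto simp: xy)
  then show ?thesis using p by (auto simp: move_def)
qed

lemma play_from_Cons:
  assumes "move p q" "play_from q ps"
  shows "play_from p (p # ps)"
proof -
  have "move ((p # ps) ! i) ((p # ps) ! Suc i)" if "Suc i < length (p # ps)" for i
    using that assms by (cases i) (auto simp: play_from_def hd_conv_nth)
  then show ?thesis using assms by (auto simp: play_from_def)
qed

lemma play_of_two_strategies: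
  assumes "strategy \<sigma>" "strategy \<tau>"
  shows "\<exists>ps. play_from p ps \<and>
    (\<forall>i. Suc i < length ps \<longrightarrow> ps ! Suc i = (if even i then \<sigma> (ps ! i) else \<tau> (ps ! i)))"
  using assms
proof (induction "fst p + snd p" arbitrary: p \<sigma> \<tau> rule: less_induct)
  case less
  show ?case
  proof (cases "p \<in> terminal_set")
    case True
    then show ?thesis by (intro exI[of _ "[p]"]) (auto simp: play_from_def)
  next
    case False
    then have mv: "move p (\<sigma> p)" using less.prems unfolding strategy_def by blast
    from less.hyps[OF move_decreases[OF mv] less.prems(2,1)] obtain ps where
      ps: "play_from (\<sigma> p) ps" and
      f: "\<And>i. Suc i < length ps \<Longrightarrow> ps ! Suc i = (if even i then \<tau> (ps ! i) else \<sigma> (ps ! i))"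
      by blast
    have hd: "ps \<noteq> []" "ps ! 0 = \<sigma> p" using ps by (auto simp: play_from_def hd_conv_nth)
    have "(p # ps) ! Suc i = (if even i then \<sigma> ((p # ps) ! i) else \<tau> ((p # ps) ! i))"
      if "Suc i < length (p # ps)" for i
      using that hd f by (cases i) auto
    then show ?thesis using play_from_Cons[OF mv ps] by blast
  qed
qed

lemma P_position_move:
  assumes "P_position p" "move p q"
  shows "\<not> P_position q"
proof
  assume "P_position q"
  then obtain \<tau> where \<tau>: "strategy \<tau>"
    "\<And>ps. play_from q ps \<Longrightarrow> previous_follows \<tau> ps \<Longrightarrow> previous_wins_play ps"
    by (auto simp: P_position_def)
  obtain \<sigma> where \<sigma>: "strategy \<sigma>"
    "\<And>ps. play_from p ps \<Longrightarrow> previous_follows \<sigma> ps \<Longrightarrow> previous_wins_play ps"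
    using assms(1) by (auto simp: P_position_def)
  obtain ps where ps: "play_from q ps" and
    f: "\<And>i. Suc i < length ps \<Longrightarrow> ps ! Suc i = (if even i then \<sigma> (ps ! i) else \<tau> (ps ! i))"
    using play_of_two_strategies[OF \<sigma>(1) \<tau>(1)] by blast
  have "previous_follows \<tau> ps" using f by (auto simp: previous_follows_def)
  with \<tau>(2) ps have "even (length ps - 1)" by (auto simp: previous_wins_play_def)
  moreover have "previous_follows \<sigma> (p # ps)"
    unfolding previous_follows_def
  proof (intro allI impI)
    fix i assume "odd i \<and> Suc i < length (p # ps)"
    then show "(p # ps) ! Suc i = \<sigma> ((p # ps) ! i)" using f by (cases i) auto
  qed
  with \<sigma>(2) play_from_Cons[OF assms(2) ps] have "even (length ps)"
    by (fastforce simp: previous_wins_play_def)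
  moreover have "length ps > 0" using ps by (auto simp: play_from_def)
  ultimately show False by auto
qed

function kernel :: "position \<Rightarrow> bool" where
  "kernel p \<longleftrightarrow> (\<forall>q. move p q \<longrightarrow> \<not> kernel q)"
  by auto
termination
  by (relation "measure (\<lambda>p. fst p + snd p)") (use move_decreases in auto)

declare kernel.simps [simp del]

lemma kernel_imp_P_position:
  assumes "kernel p"
  shows "P_position p"
proof -
  define \<sigma> where "\<sigma> r = (SOME q. move r q \<and> (kernel r \<or> kernel q))" for r
  have \<sigma>: "move r (\<sigma> r) \<and> (kernel r \<or> kernel (\<sigma> r))" if "r \<notin> terminal_set" for r
  proof -
    have "\<exists>q. move r q \<and> (kernel r \<or> kernel q)"
      using move_exists[OF that] kernel.simps[of r] by blast
    then show ?thesis unfolding \<sigma>_def by (rule someI_ex)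
  qed
  have "previous_wins_play ps" if ps: "play_from p ps" "previous_follows \<sigma> ps" for ps
  proof -
    have *: "kernel (ps ! i) \<longleftrightarrow> even i" if "i < length ps" for i
      using that
    proof (induction i)
      case 0
      then show ?case using assms ps by (auto simp: play_from_def hd_conv_nth)
    next
      case (Suc i)
      then have mv: "move (ps ! i) (ps ! Suc i)" using ps by (auto simp: play_from_def)
      show ?case
      proof (cases "even i")
        case True
        then have "kernel (ps ! i)" using Suc by auto
        with mv have "\<not> kernel (ps ! Suc i)" using kernel.simps by blast
        then show ?thesis using True by auto
      next
        case False
        then have "ps ! Suc i = \<sigma> (ps ! i)" using Suc ps by (auto simp: previous_follows_def)
        moreover have "ps ! i \<notin> terminal_set" using mv by (auto simp: move_def)
        ultimately show ?thesis using \<sigma>[of "ps ! i"] Suc False by auto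
      qed
    qed
    have "kernel (last ps)"
      using ps by (subst kernel.simps) (auto simp: play_from_def move_def)
    then show ?thesis
      using *[of "length ps - 1"] ps by (auto simp: previous_wins_play_def play_from_def last_conv_nth)
  qed
  then show ?thesis unfolding P_position_def using \<sigma> by (auto simp: strategy_def)
qed

lemma P_position_iff_kernel: "P_position p \<longleftrightarrow> kernel p"
  using kernel_imp_P_position P_position_move kernel.simps by metis

lemma P_position_iff: "P_position p \<longleftrightarrow> (\<forall>q. move p q \<longrightarrow> \<not> P_position q)"
  using kernel.simps P_position_iff_kernel by metis

end

theory Submission
  imports Defs
begin

text \<open>Write \<open>A n = \<lfloor>n\<phi>\<rfloor>\<close> and \<open>B n = \<lfloor>n(\<phi> + 1)\<rfloor> = A n + n\<close>, the complementary Beatty sequences of Wythoff's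
  game, and \<open>a n = A n + g n - 1\<close>, \<open>b n = B n + g n\<close>. No two values of \<open>B\<close> are consecutive, so for \<open>m \<ge> 1\<close>
  one has \<open>B m + 1 = A n\<close> for some \<open>n \<ge> 2\<close>, and the recursion \<open>g n = 1 - g m\<close> says that
  \<open>(a n, b m)\<close> is either \<open>(B m + 1, B m)\<close> or \<open>(B m, B m + 1)\<close>. All other \<open>A n\<close> are left
  in place. Hence \<open>a\<close> and \<open>b\<close>, restricted to \<open>n \<ge> 2\<close>, again partition the integers \<open>\<ge> 3\<close>; moreover
  \<open>a\<close> is increasing and \<open>b n - a n = n + 1\<close>. With these three facts the usual argument for Wythoff's
  game applies, the differences \<open>0, 1, 2\<close> being served by terminal positions.\<close>

section \<open>Beatty's theorem for the golden ratio\<close>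

lemma phi_square: "\<phi> * \<phi> = \<phi> + 1"
proof -
  have "sqrt 5 * sqrt 5 = (5 :: real)" by simp
  then show ?thesis by (simp add: \<phi>_def field_simps)
qed

lemma phi_less_2: "\<phi> < 2"
proof -
  have "sqrt 5 < sqrt (3\<^sup>2)" by (rule real_sqrt_less_mono) simp
  then show ?thesis by (simp add: \<phi>_def)
qed

lemma mult_phi_not_int:
  assumes "n > 0"
  shows "real n * \<phi> \<noteq> of_int k"
  using assms
proof (induction n arbitrary: k rule: less_induct)
  case (less n)
  show ?case
  proof
    assume eq: "real n * \<phi> = of_int k"
    \<comment> \<open>Descent: multiplication by \<open>\<phi>\<close> gives \<open>k\<phi> = k + n\<close>, so \<open>(k - n)\<phi> = n\<close> with \<open>0 < k - n < n\<close>.\<close>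
    have "of_int k * \<phi> = of_int k + real n"
      using eq phi_square by (metis distrib_left mult.assoc mult.right_neutral)
    then have eq': "(of_int k - real n) * \<phi> = of_int (int n)"
      using eq by (simp add: algebra_simps)
    have "real n * 1 < real n * \<phi>" "real n * \<phi> < real n * 2"
      using less.prems phi_gt_1 phi_less_2 by (intro mult_strict_left_mono; simp)+
    then have "int n < k" "k < 2 * int n" using eq by linarith+
    then have "nat (k - int n) < n" "nat (k - int n) > 0" "real (nat (k - int n)) = of_int k - real n"
      by auto
    with less.IH[of "nat (k - int n)" "int n"] eq' show False by simp
  qed
qed

abbreviation A :: "nat \<Rightarrow> int" where "A n \<equiv> \<lfloor>real n * \<phi>\<rfloor>"

abbreviation B :: "nat \<Rightarrow> int" where "B n \<equiv> \<lfloor>real n * (\<phi> + 1)\<rfloor>"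

lemma B_eq: "B n = A n + int n"
proof -
  have "real n * (\<phi> + 1) = real n * \<phi> + of_int (int n)" by (simp add: algebra_simps)
  then show ?thesis by (simp only: floor_add_int)
qed

lemma A_eqI:
  assumes "of_int k < real n * \<phi>" "real n * \<phi> < of_int k + 1"
  shows "A n = k"
  using assms by linarith

text \<open>Irrationality of \<open>\<phi>\<close> makes the lower bound strict, as Beatty's
  argument requires.\<close>

lemma A_bounds:
  assumes "n > 0"
  shows "of_int (A n) < real n * \<phi>" "real n * \<phi> < of_int (A n) + 1"
  using mult_phi_not_int[OF assms, of "A n"] by linarith+

lemma A_Suc: "A n + 1 \<le> A (Suc n)" "A (Suc n) \<le> A n + 2"
proof -
  have "real (Suc n) * \<phi> = real n * \<phi> + \<phi>" by (simp add: algebra_simps)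
  then show "A n + 1 \<le> A (Suc n)" "A (Suc n) \<le> A n + 2"
    using phi_gt_1 phi_less_2 by linarith+
qed

lemma A_strict_mono: "strict_mono A"
  unfolding strict_mono_Suc_iff using A_Suc(1) by (metis zless_add1_eq add1_zle_eq)

lemma B_Suc: "B n + 2 \<le> B (Suc n)"
  unfolding B_eq using A_Suc(1)[of n] by linarith

lemma B_strict_mono: "strict_mono B"
  unfolding strict_mono_Suc_iff
proof
  show "B n < B (Suc n)" for n using B_Suc[of n] by linarith
qed

lemma B_not_consecutive: "B m \<noteq> B k + 1"
proof
  assume eq: "B m = B k + 1"
  then have "B k < B m" by simp
  then have "Suc k \<le> m" using strict_mono_less[OF B_strict_mono] by simp
  then have "B (Suc k) \<le> B m" using strict_mono_less_eq[OF B_strict_mono] by blast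
  then show False using B_Suc[of k] eq by linarith
qed

lemma A_0: "A 0 = 0" and A_1: "A 1 = 1" and A_2: "A 2 = 3"
proof -
  show "A 0 = 0" by simp
  show "A 1 = 1" using phi_gt_1 phi_less_2 by (simp add: floor_eq_iff)
  \<comment> \<open>Otherwise \<open>\<phi> + 1 = \<phi> * \<phi> \<le> (3 / 2) * \<phi>\<close>
    would force \<open>\<phi> \<ge> 2\<close>.\<close>
  have "\<phi> > 3 / 2"
  proof (rule ccontr)
    assume "\<not> \<phi> > 3 / 2"
    then have "\<phi> * \<phi> \<le> (3 / 2) * \<phi>"
      using phi_gt_1 by (intro mult_right_mono) auto
    then show False using phi_square phi_less_2 by linarith
  qed
  then show "A 2 = 3" using phi_less_2 by (simp add: floor_eq_iff)
qed

lemma B_1: "B 1 = 2"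
  using A_1 by (simp add: B_eq)

lemma A_neq_B:
  assumes "n > 0" "m > 0"
  shows "A n \<noteq> B m"
proof
  assume eq: "A n = B m"
  define k where "k = A n"
  have "A m = k - int m" using eq B_eq[of m] k_def by simp
  \<comment> \<open>Dividing by \<open>\<phi>\<close> and \<open>\<phi> + 1\<close> and adding gives \<open>k < n + m < k + 1\<close>; here everything is scaled by
    \<open>\<phi> + 1\<close> instead, using \<open>n(\<phi> + 1) = (n\<phi>)\<phi>\<close>.\<close>
  then have m: "of_int k < real m * (\<phi> + 1)" "real m * (\<phi> + 1) < of_int k + 1"
    using A_bounds[OF assms(2)] by (simp_all add: algebra_simps)
  have "of_int k * \<phi> < real n * \<phi> * \<phi>" "real n * \<phi> * \<phi> < (of_int k + 1) * \<phi>"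
    using A_bounds[OF assms(1)] phi_gt_1 k_def by (intro mult_strict_right_mono; simp)+
  then have n: "of_int k * \<phi> < real n * (\<phi> + 1)" "real n * (\<phi> + 1) < (of_int k + 1) * \<phi>"
    using phi_square by (simp_all add: mult.assoc)
  have "of_int k * (\<phi> + 1) < of_int (int n + int m) * (\<phi> + 1)"
    "of_int (int n + int m) * (\<phi> + 1) < of_int (k + 1) * (\<phi> + 1)"
    using m n by (simp_all add: algebra_simps)
  then have "k < int n + int m" "int n + int m < k + 1"
    using phi_gt_1 by (simp_all only: mult_less_cancel_right of_int_less_iff)
  then show False by simp
qed

text \<open>A value \<open>k\<close> missed by \<open>A\<close> fills a gap of length 2, so
  \<open>n * \<phi> < k\<close> and \<open>k + 1 < (n + 1) * \<phi>\<close>. Multiplying by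
  \<open>\<phi>\<close> puts \<open>(k - n) * \<phi>\<close> between \<open>n\<close> and
  \<open>n + 1\<close>, whence \<open>B (k - n) = k\<close>.\<close>

lemma A_or_B:
  assumes "k > 0"
  shows "(\<exists>n > 0. k = A n) \<or> (\<exists>m > 0. k = B m)"
proof -
  define n where "n = Max {n. A n \<le> k}"
  have "int n \<le> A n" for n
  proof (induction n)
    case (Suc n)
    then show ?case using A_Suc(1)[of n] by linarith
  qed simp
  then have "n \<le> nat k" if "A n \<le> k" for n using that by (metis nat_int nat_mono order_trans)
  then have "{n. A n \<le> k} \<subseteq> {..nat k}" by blast
  then have fin: "finite {n. A n \<le> k}" using finite_subset by blast
  have "A 0 \<le> k" using assms by simp
  then have n: "A n \<le> k" using Max_in[OF fin] unfolding n_def by blast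
  have "\<not> A (Suc n) \<le> k" using Max_ge[OF fin, of "Suc n"] n_def by auto
  then have Sn: "k < A (Suc n)" by simp
  show ?thesis
  proof (cases "A n = k")
    case True
    then show ?thesis using assms by (metis A_0 gr0I less_irrefl)
  next
    case False
    then have 1: "A n = k - 1" "A (Suc n) = k + 1" using n Sn A_Suc[of n] by auto
    have up: "real n * \<phi> < of_int k" using 1(1) by linarith
    have lo: "of_int k + 1 < (real n + 1) * \<phi>"
      using A_bounds(1)[of "Suc n"] 1(2) by (simp add: algebra_simps)
    have "real n * 1 \<le> real n * \<phi>" using phi_gt_1 by (intro mult_left_mono) auto
    then have nk: "int n < k" using up by linarith
    \<comment> \<open>Exactly \<open>n\<close> of the integers from 1 to \<open>k\<close> are values
      of \<open>A\<close>, so \<open>k\<close> has to be value number \<open>k - n\<close> of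
      \<open>B\<close>.\<close>
    define m where "m = nat (k - int n)"
    have m: "m > 0" "real m = of_int k - real n" "int m = k - int n" using nk m_def by auto
    have "real n * \<phi> * \<phi> < of_int k * \<phi>" "(of_int k + 1) * \<phi> < (real n + 1) * \<phi> * \<phi>"
      using up lo phi_gt_1 by (intro mult_strict_right_mono; simp)+
    then have "real n * (\<phi> + 1) < of_int k * \<phi>" "(of_int k + 1) * \<phi> < (real n + 1) * (\<phi> + 1)"
      using phi_square by (simp_all only: mult.assoc)
    then have "A m = k - int m"
      using m(3) by (intro A_eqI) (simp_all add: m(2) algebra_simps)
    then have "k = B m" using B_eq[of m] by linarith
    then show ?thesis using m(1) by blast
  qed
qed

section \<open>The shifted sequences\<close>

lemma g_cases: "g n = 0 \<or> g n = 1"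
proof (induction n rule: less_induct)
  case (less n)
  consider "n = 0" | "n = 1" | "n \<ge> 2" by linarith
  then show ?case
  proof cases
    case 3
    show ?thesis
    proof (cases "\<exists>m. A n = B m + 1")
      case True
      then obtain m where m: "A n = B m + 1" by blast
      then show ?thesis using g_link[OF 3 m] less.IH[OF link_less[OF m]] by auto
    qed (use g_no_link[OF 3] in blast)
  qed (use g_0 g_1 in auto)
qed

lemma g_eq_0_link:
  assumes "n \<ge> 2" "g n = 0"
  obtains m where "m > 0" "A n = B m + 1" "g m = 1"
proof -
  obtain m where m: "A n = B m + 1" using assms g_no_link[OF assms(1)] by auto
  have "A 1 < A n" using strict_monoD[OF A_strict_mono, of 1 n] assms by simp
  then have "m > 0" using m unfolding A_1 by (cases m) auto
  then show thesis using that m g_link[OF assms(1) m] assms(2) by simp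
qed

definition a :: "nat \<Rightarrow> int" where "a n = A n + g n - 1"

definition b :: "nat \<Rightarrow> int" where "b n = B n + g n"

lemma b_eq: "b n = a n + int n + 1"
  by (simp add: a_def b_def B_eq)

lemma B_plus_1_is_A:
  assumes "m > 0"
  obtains n where "n \<ge> 2" "A n = B m + 1" "g n = 1 - g m"
proof -
  have "B 0 < B m" using strict_monoD[OF B_strict_mono assms] .
  then have pos: "B m > 0" by simp
  then obtain n where n: "n > 0" "A n = B m + 1"
    using A_or_B[of "B m + 1"] B_not_consecutive by (metis add_pos_pos zero_less_one)
  \<comment> \<open>Index 1 must be excluded because \<open>g 1\<close> is prescribed and does not
    obey the recursion.\<close>
  have "n \<noteq> 1" using n(2) pos A_1 by (metis add_0 add_right_cancel less_irrefl)
  then have "n \<ge> 2" using n(1) by simp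
  then show thesis using that n(2) g_link by blast
qed

text \<open>The critical case is a lowered \<open>A (Suc n) = B m + 1\<close>. The integer just
  below it belongs to \<open>B\<close>, so \<open>A\<close> jumps by 2 there and absorbs the
  loss.\<close>

lemma a_less_Suc: "n > 0 \<Longrightarrow> a n < a (Suc n)"
proof -
  assume n: "n > 0"
  consider "g (Suc n) = 1" | "g (Suc n) = 0" using g_cases by blast
  then show ?thesis
  proof cases
    case 1
    then show ?thesis using A_Suc(1)[of n] g_cases[of n] by (auto simp: a_def)
  next
    case 2
    then obtain m where m: "m > 0" "A (Suc n) = B m + 1"
      using g_eq_0_link[of "Suc n"] n by auto
    then have "A n \<noteq> A (Suc n) - 1" using A_neq_B[OF n m(1)] by simp
    then show ?thesis using A_Suc(1)[of n] g_cases[of n] 2 by (auto simp: a_def)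
  qed
qed

lemma a_less:
  assumes "0 < m" "m < n"
  shows "a m < a n"
  using assms(2)
proof (induction n)
  case (Suc n)
  then show ?case using a_less_Suc[of n] assms(1) by (cases "m = n") auto
qed simp

lemma a_eq_iff: "0 < m \<Longrightarrow> 0 < n \<Longrightarrow> a m = a n \<longleftrightarrow> m = n"
  using a_less by (metis less_irrefl linorder_neqE_nat)

lemma b_eq_iff:
  assumes "0 < m" "0 < n"
  shows "b m = b n \<longleftrightarrow> m = n"
  using a_less[of m n] a_less[of n m] assms unfolding b_eq by (cases m n rule: linorder_cases) auto

lemma a_0: "a 0 = 0" and a_1: "a 1 = 0" and a_2: "a 2 = 3"
proof -
  show "a 0 = 0" by (simp add: a_def g_0)
  show "a 1 = 0" by (simp only: a_def g_1 A_1)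
  have "A 2 = B 1 + 1" unfolding A_2 B_1 by simp
  then have "g 2 = 1" using g_link[of 2 1] g_1 by simp
  then show "a 2 = 3" unfolding a_def A_2 by simp
qed

lemma a_ge_3: "n \<ge> 2 \<Longrightarrow> a n \<ge> 3"
  using a_less[of 2 n] a_2 by (cases "n = 2") auto

text \<open>If \<open>g n = 0\<close>, then \<open>a n\<close> is some \<open>B k\<close> with
  \<open>g k = 1\<close>; equality with \<open>B m + g m\<close> contradicts \<open>g m = 0\<close>
  or the gaps of \<open>B\<close>. If \<open>g n = 1\<close>, then \<open>A n\<close> equals
  \<open>B m\<close>, or it equals \<open>B m + 1\<close> with \<open>g m = 1\<close>, where the
  recursion gives \<open>g n = 0\<close>.\<close>

lemma a_neq_b:
  assumes "n \<ge> 2" "m \<ge> 2"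
  shows "a n \<noteq> b m"
proof
  assume eq: "a n = b m"
  have m: "m > 0" and n: "n > 0" using assms by auto
  obtain l where l: "A l = B m + 1" "g l = 1 - g m" using B_plus_1_is_A[OF m] by metis
  show False
  proof (cases "g n = 0")
    case True
    then obtain k where k: "A n = B k + 1" "g k = 1" using g_eq_0_link[OF assms(1)] by metis
    then have "B k = B m + g m" using eq True by (simp add: a_def b_def)
    then show False
      using g_cases[of m] B_not_consecutive[of k m] floor_phi_plus_1_inj[of k m] k(2) by auto
  next
    case False
    then have "g n = 1" using g_cases by blast
    then have "A n = B m + g m" using eq by (simp add: a_def b_def)
    then show False
      using g_cases[of m] A_neq_B[OF n m] l \<open>g n = 1\<close> strict_mono_eq[OF A_strict_mono, of n l] by auto
  qed
qed

text \<open>By Beatty, \<open>k\<close> is an \<open>A n\<close> or a \<open>B m\<close>. If it was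
  not moved, it is \<open>a n\<close> or \<open>b m\<close>; if it was moved, its neighbour in the
  exchange has taken its place.\<close>

lemma a_or_b:
  assumes "k \<ge> 3"
  shows "(\<exists>n\<ge>2. k = a n) \<or> (\<exists>n\<ge>2. k = b n)"
proof -
  consider n where "n > 0" "k = A n" | m where "m > 0" "k = B m"
    using A_or_B[of k] assms by force
  then show ?thesis
  proof cases
    case 1
    have "n \<noteq> 1" using 1(2) A_1 assms by (metis numeral_le_one_iff semiring_norm(70))
    then have n: "n \<ge> 2" using 1 by simp
    show ?thesis
    proof (cases "g n = 0")
      case True
      then obtain m where m: "m > 0" "A n = B m + 1" "g m = 1" using g_eq_0_link[OF n] by metis
      then have "m \<noteq> 1" using g_1 by auto
      then have "m \<ge> 2" "k = b m" using m 1 by (auto simp: b_def)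
      then show ?thesis by blast
    next
      case False
      then have "k = a n" using g_cases[of n] 1 by (simp add: a_def)
      then show ?thesis using n by blast
    qed
  next
    case 2
    have "m \<noteq> 1" using 2(2) B_1 assms by fastforce
    then have m: "m \<ge> 2" using 2 by simp
    show ?thesis
    proof (cases "g m = 0")
      case True
      then show ?thesis using m 2 by (auto simp: b_def)
    next
      case False
      obtain n where n: "n \<ge> 2" "A n = B m + 1" "g n = 1 - g m"
        using B_plus_1_is_A[OF 2(1)] by metis
      then have "k = a n" using False g_cases[of m] 2 by (auto simp: a_def)
      then show ?thesis using n by blast
    qed
  qed
qed

section \<open>The P-positions\<close>

text \<open>The indices 0 and 1 are left out because they give the terminal pairs (0, 1) and (0,
  2).\<close>

definition cold :: "position \<Rightarrow> bool" where
  "cold p \<longleftrightarrow> p \<in> terminal_set \<or>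
     (\<exists>n\<ge>2. (int (fst p), int (snd p)) \<in> {(a n, b n), (b n, a n)})"

lemma cold_swap: "cold (y, x) \<longleftrightarrow> cold (x, y)"
  by (auto simp: cold_def terminal_set_def)

lemma move_swap: "move (x, y) (u, v) \<Longrightarrow> move (y, x) (v, u)"
  by (auto simp: move_def terminal_set_def min.commute elim!: wythoff_move.cases
      intro: wythoff_move.intros)

lemma P1_eq: "P1 = {(int x, int y) | x y. cold (x, y)}"
proof -
  have split: "(\<exists>n. Q n) \<longleftrightarrow> Q 0 \<or> Q 1 \<or> (\<exists>n\<ge>2. Q n)" for Q :: "nat \<Rightarrow> bool"
    by (metis One_nat_def less_2_cases not_le)
  have b01: "b 0 = 1" "b 1 = 2" using a_0 a_1 by (simp_all add: b_eq)
  have P1: "(u, v) \<in> P1 \<longleftrightarrow> (u, v) \<in> {(0,0), (1,1), (0,1), (1,0), (0,2), (2,0)} \<or>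
      (\<exists>n\<ge>2. (u, v) = (a n, b n)) \<or> (\<exists>n\<ge>2. (u, v) = (b n, a n))" for u v
  proof -
    have "(u, v) \<in> P11 \<longleftrightarrow> (\<exists>n. (u, v) = (a n, b n))" by (simp add: P11_def a_def b_def)
    moreover have "(u, v) \<in> P12 \<longleftrightarrow> (\<exists>n. (u, v) = (b n, a n))" by (simp add: P12_def a_def b_def)
    ultimately show ?thesis
      unfolding P1_def Un_iff split[of "\<lambda>n. (u, v) = (a n, b n)"] split[of "\<lambda>n. (u, v) = (b n, a n)"]
        b01 a_0 a_1 by blast
  qed
  have terminal: "(u, v) \<in> {(0,0), (1,1), (0,1), (1,0), (0,2), (2,0)} \<longleftrightarrow>
      (\<exists>x y. u = int x \<and> v = int y \<and> (x, y) \<in> terminal_set)" for u v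
  proof
    assume "(u, v) \<in> {(0,0), (1,1), (0,1), (1,0), (0,2), (2,0)}"
    then show "\<exists>x y. u = int x \<and> v = int y \<and> (x, y) \<in> terminal_set"
      by (intro exI[of _ "nat u"] exI[of _ "nat v"]) (auto simp: terminal_set_def)
  next
    assume "\<exists>x y. u = int x \<and> v = int y \<and> (x, y) \<in> terminal_set"
    then obtain x y where xy: "u = int x" "v = int y" "x + y \<le> 2" by (auto simp: terminal_set_def)
    have "x = 0 \<or> x = 1 \<or> x = 2" "y = 0 \<or> y = 1 \<or> y = 2" using xy by linarith+
    then show "(u, v) \<in> {(0,0), (1,1), (0,1), (1,0), (0,2), (2,0)}" using xy by auto
  qed
  have ab: "\<exists>x y. a n = int x \<and> b n = int y" if "n \<ge> 2" for n
    using a_ge_3[OF that] b_eq[of n] by (intro exI[of _ "nat (a n)"] exI[of _ "nat (b n)"]) auto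
  have "(u, v) \<in> P1 \<longleftrightarrow> (\<exists>x y. u = int x \<and> v = int y \<and> cold (x, y))" for u v
    unfolding P1 terminal cold_def using ab by fastforce
  then show ?thesis by (auto simp: set_eq_iff)
qed

text \<open>A horizontal or vertical move keeps a coordinate, and a diagonal move keeps the
  difference; each of these determines the index \<open>n\<close>.\<close>

lemma cold_move:
  assumes "cold p" "move p q"
  shows "\<not> cold q"
proof -
  have ordered: "\<not> cold q"
    if n: "n \<ge> 2" "int x = a n" "int y = b n" and mv: "wythoff_move (x, y) q" for n x y q
  proof
    assume q: "cold q"
    have x: "x \<ge> 3" and y: "y = x + n + 1" using n a_ge_3[OF n(1)] b_eq[of n] by linarith+
    obtain u v where uv: "q = (u, v)" by fastforce
    \<comment> \<open>The terminal set is out of reach: the move keeps \<open>x \<ge> 3\<close>, or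
      \<open>y > x\<close>, or the difference \<open>n + 1 \<ge> 3\<close>.\<close>
    have "u + v \<ge> 3" using mv x y n(1) unfolding uv by cases auto
    then obtain m where m: "m \<ge> 2" "int u = a m \<and> int v = b m \<or> int u = b m \<and> int v = a m"
      using q by (auto simp: uv cold_def terminal_set_def)
    have neq: "a n \<noteq> b m" "a m \<noteq> b n" using a_neq_b n(1) m(1) by auto
    have eqs: "a n = a m \<longleftrightarrow> n = m" "b n = b m \<longleftrightarrow> n = m"
      using a_eq_iff b_eq_iff n(1) m(1) by auto
    from mv[unfolded uv] show False
    proof cases
      case horizontal
      then show ?thesis using n m neq eqs by auto
    next
      case vertical
      then show ?thesis using n m neq eqs by auto
    next
      case (diagonal t)
      \<comment> \<open>The positive difference forces \<open>(u, v) = (a m, b m)\<close> with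
        \<open>m = n\<close>, against \<open>u < a n\<close>.\<close>
      then have "int v - int u = int n + 1" "int u < a n" using y n by auto
      then show ?thesis using m b_eq[of m] by auto
    qed
  qed
  obtain x y u v where p: "p = (x, y)" "q = (u, v)" by fastforce
  have nt: "p \<notin> terminal_set" and mv: "wythoff_move (x, y) (u, v)" "wythoff_move (y, x) (v, u)"
    using assms(2) move_swap[of x y u v] by (auto simp: p move_def)
  obtain n where "n \<ge> 2" "int x = a n \<and> int y = b n \<or> int y = a n \<and> int x = b n"
    using assms(1) nt by (auto simp: cold_def p)
  then show ?thesis using ordered mv cold_swap p by blast
qed

text \<open>With \<open>x \<le> y\<close>, lower \<open>y\<close> to the partner of \<open>x\<close>
  if that partner is below \<open>y\<close>. Otherwise the difference is too small for
  \<open>x\<close>, and a diagonal move reaches the cold position with the same difference.\<close>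

lemma move_to_cold:
  assumes "\<not> cold p"
  shows "\<exists>q. move p q \<and> cold q"
proof -
  have ordered: "\<exists>q. move (x, y) q \<and> cold q" if "\<not> cold (x, y)" "x \<le> y" for x y
  proof -
    have nt: "(x, y) \<notin> terminal_set" using that(1) by (auto simp: cold_def)
    have diag: ?thesis if "cold (u, v)" "u < x" "v + x = u + y" for u v
    proof -
      have "(u, v) = (x - (x - u), y - (x - u))" using that \<open>x \<le> y\<close> by auto
      then have "wythoff_move (x, y) (u, v)"
        using wythoff_move.diagonal[of "x - u" x y] that \<open>x \<le> y\<close> by simp
      then show ?thesis using nt that(1) by (auto simp: move_def)
    qed
    have vert: ?thesis if "cold (x, v)" "v < y" for v
      using nt that wythoff_move.vertical unfolding move_def by blast
    show ?thesis
    proof (cases "x \<ge> 3")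
      case False
      then show ?thesis using vert[of 0] nt by (auto simp: cold_def terminal_set_def)
    next
      case True
      then consider n where "n \<ge> 2" "int x = a n" | n where "n \<ge> 2" "int x = b n"
        using a_or_b[of "int x"] by auto
      then show ?thesis
      proof cases
        case 1
        have "int y \<noteq> b n" using 1 that(1) by (auto simp: cold_def)
        then consider "int y > b n" | "int y < b n" by linarith
        then show ?thesis
        proof cases
          assume gt: "int y > b n"
          have "b n \<ge> 0" using 1 b_eq[of n] by linarith
          then have "cold (x, nat (b n))" using 1 by (auto simp: cold_def)
          then show ?thesis using vert gt \<open>b n \<ge> 0\<close> by auto
        next
          assume less: "int y < b n"
          define d where "d = y - x"
          have d: "y = x + d" "d < n + 1" using d_def \<open>x \<le> y\<close> 1 less b_eq[of n] by linarith+
          show ?thesis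
          proof (cases "d \<le> 2")
            case True
            then have "cold (0, d)" by (auto simp: cold_def terminal_set_def)
            then show ?thesis using diag[of 0 d] d \<open>x \<ge> 3\<close> by auto
          next
            case False
            \<comment> \<open>The index is chosen so that
              \<open>b m - a m = m + 1 = d\<close>.\<close>
            define m where "m = d - 1"
            have m: "m \<ge> 2" "m < n" "d = m + 1" using False d m_def by auto
            have "a m \<ge> 3" "a m < a n" using a_ge_3 a_less m by auto
            moreover have "cold (nat (a m), nat (b m))"
              using m \<open>a m \<ge> 3\<close> b_eq[of m] by (auto simp: cold_def)
            ultimately show ?thesis
              using diag[of "nat (a m)" "nat (b m)"] 1 d m b_eq[of m] by auto
          qed
        qed
      next
        case 2
        have "a n \<ge> 3" "a n < int y" using a_ge_3 2 b_eq[of n] \<open>x \<le> y\<close> by auto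
        moreover from this have "cold (x, nat (a n))" using 2 by (auto simp: cold_def)
        ultimately show ?thesis using vert by auto
      qed
    qed
  qed
  obtain x y where p: "p = (x, y)" by fastforce
  show ?thesis
  proof (cases "x \<le> y")
    case True
    then show ?thesis using ordered assms p by blast
  next
    case False
    then obtain u v where "move (y, x) (u, v)" "cold (u, v)"
      using ordered[of y x] assms p cold_swap by auto
    then show ?thesis using move_swap cold_swap p by blast
  qed
qed

text \<open>Both predicates hold exactly where no move leads to a position satisfying them, and this
  recursion along decreasing coordinate sums has a unique solution.\<close>

lemma P_position_iff_cold: "P_position p \<longleftrightarrow> cold p"
proof (induction "fst p + snd p" arbitrary: p rule: less_induct)
  case less
  then have "P_position q \<longleftrightarrow> cold q" if "move p q" for q
    using move_decreases[OF that] by blast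
  then show ?case
    using P_position_iff[of p] cold_move[of p] move_to_cold[of p] by blast
qed

theorem theorem3p13:
  shows "{(int x, int y) | x y. P_position (x, y)} = P1"
  by (simp add: P_position_iff_cold P1_eq)

end
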